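(* Let $\mathbb{C}\subset^{\varphi_0}B\subset^{\varphi_1}A_1\subset^{\varphi_2}A_2\subset^{\varphi_3}\cdots$ be a tower of amalgamated noncommutative probability spaces. Then for any $k\in\mathbb{N}$ (and $N\ge k$), $(A_N,E_{k,N})$ and $(A_N,E_N)$ are compatible, i.e. $E_N(x)=E_N(E_{k,N}(x))$ for all $x\in A_N$. In particular, for the enveloping algebra $A_\infty$ of the tower, $(A_\infty,E_{k,\infty})$ and $(A_\infty,E_\infty)$ are compatible for all $k$, i.e. $E_\infty(x)=E_\infty(E_{k,\infty}(x))$ for all $x\in A_\infty$.
   Context: Algebras are unital and complex. Tower of amalgamated noncommutative probability spaces: a sequence of unital algebras $A_0=B\subset A_1\subset A_2\subset\cdots$, each a unital subalgebra of the next (common unit), a fixed linear functional $\varphi_0:B\to\mathbb{C}$, and for each $n\ge1$ a conditional expectation $\varphi_n:A_n\to A_{n-1}$, i.e. a linear map with $\varphi_n(b)=b$ and $\varphi_n(bxb')=b\varphi_n(x)b'$ for $b,b'\in A_{n-1}$, $x\in A_n$. Put $E_N=\varphi_0\varphi_1\cdots\varphi_N:A_N\to\mathbb{C}$ and, for $1\le k\le N$, $E_{k,N}=\varphi_k\varphi_{k+1}\cdots\varphi_N:A_N\to A_{k-1}$ (compositions). Enveloping spaces: $A_\infty=\bigcup_jA_j$, $E_\infty:A_\infty\to\mathbb{C}$ with $E_\infty(x)=E_j(x)$ for $x\in A_j$, and $E_{k,\infty}:A_\infty\to A_{k-1}$ with $E_{k,\infty}(x)=E_{k,j}(x)$ for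 $x\in A_j$, $j\ge k$. *)

theory Defs
  imports Complex_Main
begin

text \<open>
  The sort \<open>{ring, monoid_mult}\<close> is that of unital rings without the axiom \<open>0 \<noteq> 1\<close>, so that the
  zero algebra is not excluded.
\<close>

locale complex_algebra = vector_space scale
  for scale :: "complex \<Rightarrow> 'a::{ring, monoid_mult} \<Rightarrow> 'a" +
  assumes scale_mult_left: "scale c x * y = scale c (x * y)"
    and scale_mult_right: "x * scale c y = scale c (x * y)"
begin

definition unital_subalgebra :: "'a set \<Rightarrow> bool" where
  "unital_subalgebra S \<longleftrightarrow> subspace S \<and> 1 \<in> S \<and> (\<forall>x\<in>S. \<forall>y\<in>S. x * y \<in> S)"

definition linear_functional_on :: "'a set \<Rightarrow> ('a \<Rightarrow> complex) \<Rightarrow> bool" where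
  "linear_functional_on S f \<longleftrightarrow>
     (\<forall>x\<in>S. \<forall>y\<in>S. f (x + y) = f x + f y) \<and> (\<forall>c. \<forall>x\<in>S. f (scale c x) = c * f x)"

definition conditional_expectation :: "'a set \<Rightarrow> 'a set \<Rightarrow> ('a \<Rightarrow> 'a) \<Rightarrow> bool" where
  "conditional_expectation S D f \<longleftrightarrow>
     f ` S \<subseteq> D \<and>
     (\<forall>x\<in>S. \<forall>y\<in>S. f (x + y) = f x + f y) \<and>
     (\<forall>c. \<forall>x\<in>S. f (scale c x) = scale c (f x)) \<and>
     (\<forall>b\<in>D. f b = b) \<and>
     (\<forall>b\<in>D. \<forall>b'\<in>D. \<forall>x\<in>S. f (b * x * b') = b * f x * b')"

end

text \<open>
  All algebras of the tower are subalgebras of one ambient algebra, with \<open>A 0\<close> in the role of \<open>B\<close>;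
  this loses no generality, as the enveloping algebra can serve as the ambient one.
  The functional on \<open>B\<close> is \<open>\<phi>\<^sub>0\<close>; the conditional expectations are \<open>\<phi> n\<close> for \<open>n \<ge> 1\<close>, and \<open>\<phi> 0\<close> is
  never used. The maps are total functions about which nothing is assumed outside their domains.
\<close>

locale amalgamated_tower = complex_algebra scale
  for scale :: "complex \<Rightarrow> 'a::{ring, monoid_mult} \<Rightarrow> 'a" +
  fixes A :: "nat \<Rightarrow> 'a set" and \<phi>\<^sub>0 :: "'a \<Rightarrow> complex" and \<phi> :: "nat \<Rightarrow> 'a \<Rightarrow> 'a"
  assumes unital_subalgebra_A: "unital_subalgebra (A n)"
    and A_subset: "A n \<subseteq> A (Suc n)"
    and linear_\<phi>\<^sub>0: "linear_functional_on (A 0) \<phi>\<^sub>0"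
    and conditional_expectation_\<phi>: "n \<ge> 1 \<Longrightarrow> conditional_expectation (A n) (A (n - 1)) (\<phi> n)"

text \<open>\<open>tower_cond \<phi> k N\<close> is the composition \<open>\<phi> k \<circ> \<phi> (k + 1) \<circ> \<dots> \<circ> \<phi> N\<close>.\<close>

definition tower_cond :: "(nat \<Rightarrow> 'a \<Rightarrow> 'a) \<Rightarrow> nat \<Rightarrow> nat \<Rightarrow> 'a \<Rightarrow> 'a" where
  "tower_cond \<phi> k N = foldr (\<circ>) (map \<phi> [k..<Suc N]) id"

definition tower_exp :: "('a \<Rightarrow> complex) \<Rightarrow> (nat \<Rightarrow> 'a \<Rightarrow> 'a) \<Rightarrow> nat \<Rightarrow> 'a \<Rightarrow> complex" where
  "tower_exp \<phi>\<^sub>0 \<phi> N = \<phi>\<^sub>0 \<circ> tower_cond \<phi> 1 N"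

definition env_algebra :: "(nat \<Rightarrow> 'a set) \<Rightarrow> 'a set" where
  "env_algebra A = (\<Union>j. A j)"

text \<open>The descriptions below are well defined on the enveloping algebra; see the lemmas
  \<open>env_cond_eq\<close> and \<open>env_exp_eq\<close>.\<close>

definition env_cond :: "(nat \<Rightarrow> 'a set) \<Rightarrow> (nat \<Rightarrow> 'a \<Rightarrow> 'a) \<Rightarrow> nat \<Rightarrow> 'a \<Rightarrow> 'a" where
  "env_cond A \<phi> k x = (THE y. \<forall>j\<ge>k. x \<in> A j \<longrightarrow> y = tower_cond \<phi> k j x)"

definition env_exp ::
    "(nat \<Rightarrow> 'a set) \<Rightarrow> ('a \<Rightarrow> complex) \<Rightarrow> (nat \<Rightarrow> 'a \<Rightarrow> 'a) \<Rightarrow> 'a \<Rightarrow> complex" where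
  "env_exp A \<phi>\<^sub>0 \<phi> x = (THE z. \<forall>j. x \<in> A j \<longrightarrow> z = tower_exp \<phi>\<^sub>0 \<phi> j x)"

text \<open>Compatibility of \<open>(S, E)\<close>, where \<open>E\<close> maps \<open>S\<close> to a subalgebra, with \<open>(S, F)\<close>, where \<open>F\<close> is
  scalar-valued.\<close>

definition compatible :: "'a set \<Rightarrow> ('a \<Rightarrow> 'a) \<Rightarrow> ('a \<Rightarrow> complex) \<Rightarrow> bool" where
  "compatible S E F \<longleftrightarrow> (\<forall>x\<in>S. F x = F (E x))"

lemma tower_cond_self: "tower_cond \<phi> k k = \<phi> k"
  by (simp add: tower_cond_def)

lemma foldr_comp_id: "foldr (\<circ>) fs g = foldr (\<circ>) fs id \<circ> g"
  by (induction fs) (simp_all add: comp_assoc)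

lemma tower_cond_Suc: "k \<le> Suc N \<Longrightarrow> tower_cond \<phi> k (Suc N) x = tower_cond \<phi> k N (\<phi> (Suc N) x)"
  unfolding tower_cond_def
  using foldr_comp_id[of "map \<phi> [k..<Suc N]" "\<phi> (Suc N)"] by simp

lemma tower_exp_0: "tower_exp \<phi>\<^sub>0 \<phi> 0 = \<phi>\<^sub>0"
  by (simp add: tower_exp_def tower_cond_def)

lemma tower_exp_Suc: "tower_exp \<phi>\<^sub>0 \<phi> (Suc N) x = tower_exp \<phi>\<^sub>0 \<phi> N (\<phi> (Suc N) x)"
  by (simp add: tower_exp_def tower_cond_Suc)

context amalgamated_tower
begin

lemma A_mono: "i \<le> j \<Longrightarrow> A i \<subseteq> A j"
  using A_subset by (rule lift_Suc_mono_le)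

lemma \<phi>_range: "x \<in> A (Suc n) \<Longrightarrow> \<phi> (Suc n) x \<in> A n"
  and \<phi>_id: "x \<in> A n \<Longrightarrow> \<phi> (Suc n) x = x"
  using conditional_expectation_\<phi>[of "Suc n"] by (auto simp: conditional_expectation_def)

lemma tower_cond_range:
  assumes "1 \<le> k" "k \<le> N" "x \<in> A N"
  shows "tower_cond \<phi> k N x \<in> A (k - 1)"
  using assms(2,3)
proof (induction N arbitrary: x rule: dec_induct)
  case base
  then show ?case using \<phi>_range[of x "k - 1"] assms(1) by (simp add: tower_cond_self)
next
  case (step N)
  then show ?case by (simp add: tower_cond_Suc \<phi>_range)
qed

lemma tower_cond_ext:
  assumes "k \<le> i" "i \<le> j" "x \<in> A i"
  shows "tower_cond \<phi> k j x = tower_cond \<phi> k i x"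
  using assms(2)
proof (induction j rule: dec_induct)
  case (step j)
  then have "x \<in> A j" using A_mono[of i j] assms(3) by auto
  then show ?case using step assms(1) by (simp add: tower_cond_Suc \<phi>_id)
qed simp

lemma tower_exp_ext:
  assumes "i \<le> j" "x \<in> A i"
  shows "tower_exp \<phi>\<^sub>0 \<phi> j x = tower_exp \<phi>\<^sub>0 \<phi> i x"
  using assms(1)
proof (induction j rule: dec_induct)
  case (step j)
  then have "x \<in> A j" using A_mono[of i j] assms(2) by auto
  then show ?case using step by (simp add: tower_exp_Suc \<phi>_id)
qed simp

lemma env_cond_eq:
  assumes "k \<le> j" "x \<in> A j"
  shows "env_cond A \<phi> k x = tower_cond \<phi> k j x"
  unfolding env_cond_def
proof (rule the_equality)
  show "\<forall>i\<ge>k. x \<in> A i \<longrightarrow> tower_cond \<phi> k j x = tower_cond \<phi> k i x"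
    using assms tower_cond_ext by (metis nat_le_linear)
qed (use assms in blast)

lemma env_exp_eq:
  assumes "x \<in> A j"
  shows "env_exp A \<phi>\<^sub>0 \<phi> x = tower_exp \<phi>\<^sub>0 \<phi> j x"
  unfolding env_exp_def
proof (rule the_equality)
  show "\<forall>i. x \<in> A i \<longrightarrow> tower_exp \<phi>\<^sub>0 \<phi> j x = tower_exp \<phi>\<^sub>0 \<phi> i x"
    using assms tower_exp_ext by (metis nat_le_linear)
qed (use assms in blast)

end

end

theory Submission
  imports Defs
begin

text \<open>Regrouping the composition gives E_N = E_{k-1} o E_{k,N}
  (\<open>tower_exp_factor\<close>). The values of E_{k,N} lie in A_{k-1}, where each of phi_k, ...,
  phi_N is the identity, so E_N and E_{k-1} agree on them. Hence E_N(E_{k,N}(x)) =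
  E_{k-1}(E_{k,N}(x)) = E_N(x). The enveloping case reduces to one finite level.\<close>

lemma tower_exp_factor:
  assumes "1 \<le> k" "k \<le> N"
  shows "tower_exp \<phi>\<^sub>0 \<phi> N x = tower_exp \<phi>\<^sub>0 \<phi> (k - 1) (tower_cond \<phi> k N x)"
  using assms(2)
proof (induction N arbitrary: x rule: dec_induct)
  case base
  \<comment> \<open>Since \<open>1 \<le> k\<close>, \<open>k\<close> is \<open>Suc (k - 1)\<close>,
    and the claim is E_k = E_{k-1} o phi_k.\<close>
  then show ?case using tower_exp_Suc[of \<phi>\<^sub>0 \<phi> "k - 1"] assms(1) by (simp add: tower_cond_self)
next
  case (step N)
  then show ?case by (simp add: tower_exp_Suc tower_cond_Suc)
qed

context amalgamated_tower
begin

lemma tower_exp_tower_cond: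
  assumes "1 \<le> k" "k \<le> N" "x \<in> A N"
  shows "tower_exp \<phi>\<^sub>0 \<phi> N (tower_cond \<phi> k N x) = tower_exp \<phi>\<^sub>0 \<phi> N x"
proof -
  have "tower_exp \<phi>\<^sub>0 \<phi> N (tower_cond \<phi> k N x) = tower_exp \<phi>\<^sub>0 \<phi> (k - 1) (tower_cond \<phi> k N x)"
    using assms by (intro tower_exp_ext tower_cond_range) simp_all
  then show ?thesis using tower_exp_factor[OF assms(1,2)] by metis
qed

lemma env_exp_env_cond:
  assumes "1 \<le> k" "x \<in> env_algebra A"
  shows "env_exp A \<phi>\<^sub>0 \<phi> (env_cond A \<phi> k x) = env_exp A \<phi>\<^sub>0 \<phi> x"
proof -
  obtain i where "x \<in> A i" using assms(2) by (auto simp: env_algebra_def)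
  \<comment> \<open>Taking \<open>N = max k i\<close> reaches a level that contains \<open>x\<close>
    and on which E_{k,N} is defined.\<close>
  then obtain N where N: "k \<le> N" "x \<in> A N"
    using A_mono[of i "max k i"] by (metis max.cobounded1 max.cobounded2 subsetD)
  \<comment> \<open>With the conditioned element also in \<open>A N\<close>, both values of
    \<open>env_exp\<close> can be computed at the same level \<open>N\<close>.\<close>
  have "tower_cond \<phi> k N x \<in> A N"
    using tower_cond_range[OF assms(1) N] A_mono[of "k - 1" N] N(1)
    by (meson diff_le_self le_trans subsetD)
  then show ?thesis
    using N assms(1) by (simp add: env_cond_eq env_exp_eq tower_exp_tower_cond)
qed

end

theorem theorem2p16:
  fixes scale :: "complex \<Rightarrow> 'a::{ring, monoid_mult} \<Rightarrow> 'a"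
    and A :: "nat \<Rightarrow> 'a set"
    and \<phi>\<^sub>0 :: "'a \<Rightarrow> complex"
    and \<phi> :: "nat \<Rightarrow> 'a \<Rightarrow> 'a"
  assumes "amalgamated_tower scale A \<phi>\<^sub>0 \<phi>"
  shows "(\<forall>k\<ge>1. \<forall>N\<ge>k. compatible (A N) (tower_cond \<phi> k N) (tower_exp \<phi>\<^sub>0 \<phi> N)) \<and>
         (\<forall>k\<ge>1. compatible (env_algebra A) (env_cond A \<phi> k) (env_exp A \<phi>\<^sub>0 \<phi>))"
proof -
  interpret amalgamated_tower scale A \<phi>\<^sub>0 \<phi> by (rule assms)
  show ?thesis
    by (simp add: compatible_def tower_exp_tower_cond env_exp_env_cond)
qed

end
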